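(* Let $i\in V_{trieq}$ and let $\pi\in\mathbb{R}^V$ be a dual solution of the restricted master problem with $\pi_i=0$. Then there exists an optimal cycle $C$ to the pricing problem such that $i\notin C$.
   Context: $G=(V,E)$ is a finite nonempty undirected graph with symmetric travel times $t_{i,j}\ge0$ for $\{i,j\}\in E$ (with $t_{i,j}=\infty$ for missing edges and $t_{i,i}=0$) and critical times $q_i>0$ for $i\in V$. A cycle $C=(i_0,\ldots,i_K=i_0)$ visits each of its nodes once; two-node cycles $(i,j,i)$ and singleton cycles (loops, with travel time $0$) are allowed. It is length-feasible if $t(C)=\sum_{k=1}^K t_{i_{k-1},i_k}\le q(C)=\min_k q_{i_k}$. Let $\Omega$ be the set of all length-feasible cycles. $V_{trieq}\subseteq V$ is the set of nodes $i$ such that $t_{j,k}\le t_{i,j}+t_{i,k}$ for all pairs $j,k\in V$ (a node belongs to $V_{trieq}$ only when all required bypass edges $\{j,k\}$ exist). Restricted master problem (RMP): for a subset $\Omega'\subseteq\Omega$ containing all singleton cycles, minimize $\sum_{C\in\Omega'}\lambda_C$ over $\lambda\ge0$ subject to $\sum_{C\in\Omega':\,j\in C}\lambda_C\ge1$ for $j\in V_{trieq}$ and $\sum_{C\in\Omega':\,j\in C}\lambda_C=1$ for $j\in V\setminus V_{trieq}$. A dual solution $\pi$ is the dual part of an optimal primal-dual pair $(\lambda,\pi)$ obtained by optimizing this linear program; thus $\pi_j\ge0$ for $j\in V_{trieq}$, while $\pi_j$ is unrestricted in sign for $j\in V\setminus V_{trieq}$. Pricing problem (for given $\pi$): minimize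 the reduced cost $\overline{c}(C)=1-\sum_{j\in C}\pi_j$ over all $C\in\Omega$. An optimal cycle is a minimizer. *)

theory Defs
  imports "HOL-Library.Extended_Real"
begin

locale travel_graph =
  fixes V :: "'v set"
    and E :: "'v set set"
    and t :: "'v \<Rightarrow> 'v \<Rightarrow> ereal"
    and q :: "'v \<Rightarrow> real"
  assumes finite_V: "finite V"
    and nonempty_V: "V \<noteq> {}"
    and edges: "e \<in> E \<Longrightarrow> \<exists>i\<in>V. \<exists>j\<in>V. i \<noteq> j \<and> e = {i, j}"
    and t_sym: "\<lbrakk>i \<in> V; j \<in> V\<rbrakk> \<Longrightarrow> t i j = t j i"
    and t_edge: "{i, j} \<in> E \<Longrightarrow> 0 \<le> t i j \<and> t i j < \<infinity>"
    and t_missing: "\<lbrakk>i \<in> V; j \<in> V; i \<noteq> j; {i, j} \<notin> E\<rbrakk> \<Longrightarrow> t i j = \<infinity>"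
    and t_refl: "i \<in> V \<Longrightarrow> t i i = 0"
    and q_pos: "i \<in> V \<Longrightarrow> 0 < q i"

(* A cycle is the list [i_0, ..., i_K] with i_K = i_0 and K >= 1; singleton cycles are [i, i]
   and two-node cycles are [i, j, i].  Edges are not required here: a missing edge makes the
   travel time infinite, so that length-feasible cycles only use edges of the graph.
   Rotations and reversals of a cycle are different lists with the same node set and travel time. *)
definition is_cycle :: "'v set \<Rightarrow> 'v list \<Rightarrow> bool" where
  "is_cycle V C \<longleftrightarrow> 2 \<le> length C \<and> hd C = last C \<and> distinct (tl C) \<and> set C \<subseteq> V"

definition cycle_time :: "('v \<Rightarrow> 'v \<Rightarrow> ereal) \<Rightarrow> 'v list \<Rightarrow> ereal" where
  "cycle_time t C = (\<Sum>k = 1..length C - 1. t (C ! (k - 1)) (C ! k))"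

definition critical_time :: "('v \<Rightarrow> real) \<Rightarrow> 'v list \<Rightarrow> real" where
  "critical_time q C = Min (q ` set C)"

definition feasible_cycles ::
    "'v set \<Rightarrow> ('v \<Rightarrow> 'v \<Rightarrow> ereal) \<Rightarrow> ('v \<Rightarrow> real) \<Rightarrow> 'v list set" where
  "feasible_cycles V t q = {C. is_cycle V C \<and> cycle_time t C \<le> ereal (critical_time q C)}"

definition V_trieq :: "'v set \<Rightarrow> ('v \<Rightarrow> 'v \<Rightarrow> ereal) \<Rightarrow> 'v set" where
  "V_trieq V t = {i \<in> V. \<forall>j\<in>V. \<forall>k\<in>V. t j k \<le> t i j + t i k}"

(* The vector x holds the primal variables, one for each cycle in \<Omega>'. *)
definition rmp_feasible ::
    "'v set \<Rightarrow> ('v \<Rightarrow> 'v \<Rightarrow> ereal) \<Rightarrow> 'v list set \<Rightarrow> ('v list \<Rightarrow> real) \<Rightarrow> bool" where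
  "rmp_feasible V t \<Omega>' x \<longleftrightarrow>
     (\<forall>C\<in>\<Omega>'. 0 \<le> x C) \<and>
     (\<forall>j\<in>V_trieq V t. (\<Sum>C\<in>{C \<in> \<Omega>'. j \<in> set C}. x C) \<ge> 1) \<and>
     (\<forall>j\<in>V - V_trieq V t. (\<Sum>C\<in>{C \<in> \<Omega>'. j \<in> set C}. x C) = 1)"

definition rmp_optimal ::
    "'v set \<Rightarrow> ('v \<Rightarrow> 'v \<Rightarrow> ereal) \<Rightarrow> 'v list set \<Rightarrow> ('v list \<Rightarrow> real) \<Rightarrow> bool" where
  "rmp_optimal V t \<Omega>' x \<longleftrightarrow>
     is_arg_min (\<lambda>l. \<Sum>C\<in>\<Omega>'. l C) (rmp_feasible V t \<Omega>') x"

(* The linear programming dual: maximise the sum of the \<pi> j, subject to one constraint per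
   cycle in \<Omega>' (cost coefficient 1) and to the sign condition for the covering constraints. *)
definition rmp_dual_feasible ::
    "'v set \<Rightarrow> ('v \<Rightarrow> 'v \<Rightarrow> ereal) \<Rightarrow> 'v list set \<Rightarrow> ('v \<Rightarrow> real) \<Rightarrow> bool" where
  "rmp_dual_feasible V t \<Omega>' \<pi> \<longleftrightarrow>
     (\<forall>C\<in>\<Omega>'. (\<Sum>j\<in>set C. \<pi> j) \<le> 1) \<and> (\<forall>j\<in>V_trieq V t. 0 \<le> \<pi> j)"

definition rmp_dual_optimal ::
    "'v set \<Rightarrow> ('v \<Rightarrow> 'v \<Rightarrow> ereal) \<Rightarrow> 'v list set \<Rightarrow> ('v \<Rightarrow> real) \<Rightarrow> bool" where
  "rmp_dual_optimal V t \<Omega>' \<pi> \<longleftrightarrow>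
     is_arg_max (\<lambda>p. \<Sum>j\<in>V. p j) (rmp_dual_feasible V t \<Omega>') \<pi>"

definition rmp_dual_solution ::
    "'v set \<Rightarrow> ('v \<Rightarrow> 'v \<Rightarrow> ereal) \<Rightarrow> 'v list set \<Rightarrow> ('v \<Rightarrow> real) \<Rightarrow> bool" where
  "rmp_dual_solution V t \<Omega>' \<pi> \<longleftrightarrow>
     (\<exists>x. rmp_optimal V t \<Omega>' x \<and> rmp_dual_optimal V t \<Omega>' \<pi>)"

definition reduced_cost :: "('v \<Rightarrow> real) \<Rightarrow> 'v list \<Rightarrow> real" where
  "reduced_cost \<pi> C = 1 - (\<Sum>j\<in>set C. \<pi> j)"

definition pricing_optimal ::
    "'v set \<Rightarrow> ('v \<Rightarrow> 'v \<Rightarrow> ereal) \<Rightarrow> ('v \<Rightarrow> real) \<Rightarrow> ('v \<Rightarrow> real) \<Rightarrow> 'v list \<Rightarrow> bool" where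
  "pricing_optimal V t q \<pi> C \<longleftrightarrow>
     is_arg_min (reduced_cost \<pi>) (\<lambda>D. D \<in> feasible_cycles V t q) C"

end

theory Submission
  imports Defs
begin

text \<open>Shortcutting an optimal cycle past \<open>i\<close> keeps it length-feasible by the triangle inequality,
  and leaves its reduced cost unchanged because \<open>\<pi> i = 0\<close>. This only fails if the optimal cycle is
  the loop at \<open>i\<close>. But the indicator vector of \<open>i\<close> is dual feasible, so \<open>\<pi>\<close> has total at
  least 1; hence some \<open>\<pi> j\<close> is positive and the loop at \<open>j\<close> is strictly better than the one at \<open>i\<close>.\<close>

lemma cycle_time_single [simp]: "cycle_time t [x] = 0"
  by (simp add: cycle_time_def)

text \<open>Peeling off the first leg turns the indexed sum into a recursion on lists, which the
  simplifier can use.\<close>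

lemma cycle_time_Cons_Cons [simp]:
  "cycle_time t (x # y # zs) = t x y + cycle_time t (y # zs)"
proof -
  have "cycle_time t (x # y # zs)
      = (\<Sum>k = 1..Suc (length zs). t ((x # y # zs) ! (k - 1)) ((x # y # zs) ! k))"
    by (simp add: cycle_time_def)
  also have "\<dots> = t x y + (\<Sum>k = Suc 1..Suc (length zs). t ((x # y # zs) ! (k - 1)) ((x # y # zs) ! k))"
    by (subst sum.atLeast_Suc_atMost) simp_all
  also have "(\<Sum>k = Suc 1..Suc (length zs). t ((x # y # zs) ! (k - 1)) ((x # y # zs) ! k))
      = cycle_time t (y # zs)"
    unfolding cycle_time_def sum.shift_bounds_cl_Suc_ivl
    by (intro sum.cong) (auto simp: nth_Cons')
  finally show ?thesis .
qed

text \<open>\<open>cycle_time\<close> makes sense for open walks too. The cut node \<open>x\<close>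
  belongs to both pieces, so the legs into and out of it are each counted exactly once.\<close>

lemma cycle_time_append:
  "cycle_time t (xs @ x # ys) = cycle_time t (xs @ [x]) + cycle_time t (x # ys)"
proof (induction xs)
  case (Cons a xs)
  then show ?case by (cases xs) (simp_all add: add.assoc)
qed simp

text \<open>Only the tail of a cycle is distinct, hence the length bound
  \<open>Suc (card V)\<close>. Finiteness guarantees that the pricing problem attains its
  minimum.\<close>

lemma finite_is_cycle:
  assumes "finite V"
  shows "finite {C. is_cycle V C}"
proof (rule finite_subset)
  show "{C. is_cycle V C} \<subseteq> {C. set C \<subseteq> V \<and> length C \<le> Suc (card V)}"
  proof clarify
    fix C assume C: "is_cycle V C"
    then have "set (tl C) \<subseteq> V"
      by (cases C) (auto simp: is_cycle_def)
    then have "length (tl C) \<le> card V"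
      using C assms by (metis card_mono distinct_card is_cycle_def)
    then show "set C \<subseteq> V \<and> length C \<le> Suc (card V)"
      using C by (auto simp: is_cycle_def)
  qed
  show "finite {C. set C \<subseteq> V \<and> length C \<le> Suc (card V)}"
    using assms by (rule finite_lists_length_le)
qed

text \<open>In the definition of \<open>V_trieq\<close> both legs start at \<open>i\<close>;
  symmetry reverses the first, giving a detour from \<open>a\<close> to \<open>b\<close> through
  \<open>i\<close>.\<close>

lemma V_trieq_triangle:
  assumes "travel_graph V E t q" "i \<in> V_trieq V t" "a \<in> V" "b \<in> V"
  shows "t a b \<le> t a i + t i b"
  using assms by (auto simp: V_trieq_def travel_graph.t_sym)

text \<open>The two legs at \<open>i\<close> are replaced by one direct leg between its neighbours.
  If \<open>i\<close> is the base node, it occurs at both ends of the list, so the shortened cycle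
  needs a new base node; the condition on \<open>set C\<close> ensures that one remains.\<close>

lemma is_cycle_bypass:
  assumes G: "travel_graph V E t q" and i: "i \<in> V_trieq V t"
    and C: "is_cycle V C" and ne: "set C \<noteq> {i}" and iC: "i \<in> set C"
  obtains D where "is_cycle V D" "set D = set C - {i}" "cycle_time t D \<le> cycle_time t C"
proof (cases "hd C = i")
  case True
  from C obtain xs where xs: "C = i # xs @ [i]"
    using True unfolding is_cycle_def
    by (cases C; cases "tl C" rule: rev_cases) auto
  with ne obtain a zs where a: "xs = a # zs"
    by (cases xs) auto
  then have aV: "a \<in> V" and lV: "last xs \<in> V"
    using C xs unfolding is_cycle_def by auto
  obtain ys b where b: "xs = ys @ [b]"
    using a by (metis list.distinct(1) rev_exhaust)
  \<comment> \<open>The new cycle starts at \<open>a\<close>, the successor of \<open>i\<close>, and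
    its closing leg from \<open>b\<close> to \<open>a\<close> bypasses \<open>i\<close>. If
    \<open>xs\<close> is a single node, this is the loop at \<open>a\<close>.\<close>
  have "cycle_time t (xs @ [a]) = cycle_time t xs + t b a"
    unfolding b by (simp add: cycle_time_append[of t ys b "[a]"])
  also have "\<dots> \<le> cycle_time t xs + (t b i + t i a)"
    using V_trieq_triangle[OF G i] aV lV b by (intro add_left_mono) auto
  also have "\<dots> = t i a + cycle_time t (xs @ [i])"
    unfolding b by (simp add: cycle_time_append[of t ys b "[i]"] ac_simps)
  also have "\<dots> = cycle_time t C"
    by (simp add: xs a)
  finally have "cycle_time t (xs @ [a]) \<le> cycle_time t C" .
  moreover have "is_cycle V (xs @ [a])" "set (xs @ [a]) = set C - {i}"
    using C xs a unfolding is_cycle_def by auto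
  ultimately show ?thesis using that by blast
next
  case False
  \<comment> \<open>Head and last entry agree, so \<open>i\<close> is neither and has a predecessor
    \<open>a\<close> and a successor \<open>b\<close> in the list. These coincide for a two-node
    cycle, which shrinks to a loop.\<close>
  obtain us vs where uv: "C = us @ i # vs"
    using iC by (meson split_list)
  have "us \<noteq> []"
    using False uv by auto
  then obtain ys a where a: "us = ys @ [a]"
    by (cases us rule: rev_cases) auto
  have "vs \<noteq> []"
    using False C uv unfolding is_cycle_def by auto
  then obtain b zs where b: "vs = b # zs"
    by (cases vs) auto
  have Ceq: "C = ys @ a # i # b # zs"
    by (simp add: uv a b)
  have V: "a \<in> V" "b \<in> V"
    using C Ceq unfolding is_cycle_def by auto
  let ?D = "ys @ a # b # zs"
  have "t a b \<le> t a i + t i b"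
    using V_trieq_triangle[OF G i] V by blast
  then have "cycle_time t (ys @ [a]) + (t a b + cycle_time t (b # zs))
      \<le> cycle_time t (ys @ [a]) + ((t a i + t i b) + cycle_time t (b # zs))"
    by (intro add_left_mono add_right_mono)
  then have "cycle_time t ?D \<le> cycle_time t C"
    unfolding Ceq cycle_time_append[of t ys a "b # zs"] cycle_time_append[of t ys a "i # b # zs"]
    by (simp add: add.assoc)
  moreover have "is_cycle V ?D" "set ?D = set C - {i}"
    using C False unfolding is_cycle_def Ceq by (cases ys; auto)+
  ultimately show ?thesis using that by blast
qed

lemma critical_time_antimono:
  assumes "set D \<subseteq> set C" "D \<noteq> []"
  shows "critical_time q C \<le> critical_time q D"
  unfolding critical_time_def using assms by (intro Min_antimono) auto

theorem lemma2:
  fixes V :: "'v set" and E :: "'v set set"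
    and t :: "'v \<Rightarrow> 'v \<Rightarrow> ereal" and q :: "'v \<Rightarrow> real"
    and \<Omega>' :: "'v list set" and \<pi> :: "'v \<Rightarrow> real" and i :: 'v
  assumes "travel_graph V E t q"
    and "\<Omega>' \<subseteq> feasible_cycles V t q"
    and "\<forall>j\<in>V. [j, j] \<in> \<Omega>'"
    and "i \<in> V_trieq V t"
    and "rmp_dual_solution V t \<Omega>' \<pi>"
    and "\<pi> i = 0"
  shows "\<exists>C. pricing_optimal V t q \<pi> C \<and> i \<notin> set C"
proof -
  interpret travel_graph V E t q by fact
  let ?F = "feasible_cycles V t q"
  have iV: "i \<in> V"
    using assms(4) by (simp add: V_trieq_def)
  \<comment> \<open>The dual constraints sum over node sets, so each cycle collects at most 1 from
    \<open>i\<close>, even if its list is based at \<open>i\<close>.\<close>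
  have "rmp_dual_feasible V t \<Omega>' (\<lambda>j. if j = i then 1 else 0)"
    by (simp add: rmp_dual_feasible_def)
  then have "(\<Sum>j\<in>V. if j = i then 1 else 0) \<le> (\<Sum>j\<in>V. \<pi> j)"
    using assms(5) unfolding rmp_dual_solution_def rmp_dual_optimal_def is_arg_max_def
    by (meson linorder_not_less)
  then have "0 < (\<Sum>j\<in>V. \<pi> j)"
    using iV finite_V by simp
  then obtain j where j: "j \<in> V" "0 < \<pi> j"
    by (meson linorder_not_less sum_nonpos)
  have "finite ?F"
    by (rule finite_subset[OF _ finite_is_cycle[OF finite_V]]) (auto simp: feasible_cycles_def)
  moreover have jF: "[j, j] \<in> ?F"
    using assms(2,3) j by blast
  ultimately obtain C where C: "is_arg_min (reduced_cost \<pi>) (\<lambda>D. D \<in> ?F) C"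
    using ex_is_arg_min_if_finite[of ?F "reduced_cost \<pi>"] by auto
  show ?thesis
  proof (cases "i \<in> set C")
    case False
    then show ?thesis using C unfolding pricing_optimal_def by blast
  next
    case True
    have CF: "is_cycle V C" "cycle_time t C \<le> ereal (critical_time q C)"
      using C by (auto simp: is_arg_min_def feasible_cycles_def)
    have "reduced_cost \<pi> C \<le> reduced_cost \<pi> [j, j]"
      using C jF by (auto simp: is_arg_min_linorder)
    then have "set C \<noteq> {i}"
      using j assms(6) by (auto simp: reduced_cost_def)
    then obtain D where D: "is_cycle V D" "set D = set C - {i}" "cycle_time t D \<le> cycle_time t C"
      using is_cycle_bypass[OF assms(1,4) CF(1) _ True] by metis
    have "critical_time q C \<le> critical_time q D"
      using D(1,2) by (intro critical_time_antimono) (auto simp: is_cycle_def)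
    \<comment> \<open>The travel time did not increase, and the minimum of \<open>q\<close> over
      fewer nodes did not decrease.\<close>
    then have "D \<in> ?F"
      using D CF(2) unfolding feasible_cycles_def
      by (auto intro: order_trans)
    moreover have "reduced_cost \<pi> D = reduced_cost \<pi> C"
      using True assms(6) D(2) by (simp add: reduced_cost_def sum_diff1)
    ultimately have "pricing_optimal V t q \<pi> D"
      using C unfolding pricing_optimal_def is_arg_min_def by simp
    then show ?thesis using D(2) by blast
  qed
qed

end
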